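(* Let $m\geq 3$ and let the list $(\rho,\alpha+i\beta,\alpha-i\beta,\lambda_4,\lambda_5,\ldots,\lambda_m)$ of complex numbers be realisable, where $\rho$ is the Perron eigenvalue, $\alpha$ is real and $\beta>0$. Let $a$, $t$ and $\eta$ be any real numbers satisfying $a,t\geq 0$ and $0<\eta\leq 1$. Then the list \[ (\mu_1,\mu_2,\mu_3,\mu_4,\lambda_4,\lambda_5,\ldots,\lambda_m) \] is realisable, where $\mu_1,\mu_2,\mu_3,\mu_4$ are the roots (with multiplicity) of the polynomial \[ q(x):=(x-\rho)\left((x-\alpha)^2+\beta^2\right)(x-a)-t\left((x-\alpha)\left((1+\eta)x-\alpha-\eta\rho\right)+\beta^2\right). \]
   Context: A list of complex numbers $(\lambda_1,\ldots,\lambda_k)$ is called realisable if there is a $k\times k$ entrywise nonnegative real matrix whose spectrum (eigenvalues counted with algebraic multiplicity) is this list. The order of entries is immaterial, except that when the first entry $\rho$ of a realisable list is said to be the Perron eigenvalue, this means that $\rho$ is the spectral radius of a realising matrix, i.e. $\rho$ is a nonnegative real number equal to the maximum of the moduli of the entries of the list. Here $i$ denotes the imaginary unit. *)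

theory Defs
  imports "Jordan_Normal_Form.Spectral_Radius"
begin

text \<open>The spectrum with algebraic multiplicities is the multiset of complex roots of the
  characteristic polynomial; comparing it with \<^term>\<open>mset xs\<close> makes the order of the
  list immaterial.\<close>

definition realises :: "real mat \<Rightarrow> complex list \<Rightarrow> bool" where
  "realises A xs \<longleftrightarrow>
     A \<in> carrier_mat (length xs) (length xs) \<and>
     (\<forall>i < length xs. \<forall>j < length xs. 0 \<le> A $$ (i, j)) \<and>
     proots (char_poly (map_mat complex_of_real A)) = mset xs"

definition realisable :: "complex list \<Rightarrow> bool" where
  "realisable xs \<longleftrightarrow> (\<exists>A. realises A xs)"

definition perron_eigenvalue :: "real \<Rightarrow> complex list \<Rightarrow> bool" where
  "perron_eigenvalue \<rho> xs \<longleftrightarrow>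
     (\<exists>A. realises A xs \<and> \<rho> = spectral_radius (map_mat complex_of_real A))"

definition q_poly :: "real \<Rightarrow> real \<Rightarrow> real \<Rightarrow> real \<Rightarrow> real \<Rightarrow> real \<Rightarrow> real poly" where
  "q_poly \<rho> \<alpha> \<beta> a t \<eta> =
     [:-\<rho>, 1:] * ([:-\<alpha>, 1:]\<^sup>2 + [:\<beta>\<^sup>2:]) * [:-a, 1:]
     - [:t:] * ([:-\<alpha>, 1:] * [:-\<alpha> - \<eta> * \<rho>, 1 + \<eta>:] + [:\<beta>\<^sup>2:])"

lemma poly_q_poly:
  "poly (q_poly \<rho> \<alpha> \<beta> a t \<eta>) x =
     (x - \<rho>) * ((x - \<alpha>)\<^sup>2 + \<beta>\<^sup>2) * (x - a)
     - t * ((x - \<alpha>) * ((1 + \<eta>) * x - \<alpha> - \<eta> * \<rho>) + \<beta>\<^sup>2)"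
  by (simp add: q_poly_def algebra_simps)

end

theory Submission
  imports Defs
begin

text \<open>A nonnegative matrix with spectral radius \<open>\<rho>\<close> can be replaced by a nonnegative matrix \<open>B\<close> with the
  same characteristic polynomial and all row sums equal to \<open>\<rho>\<close>: diagonal scalings bring the row sums
  below \<open>\<rho> + \<epsilon>\<close>, a limit exists by compactness, and the remaining deficits can be filled without
  changing the spectrum. If \<open>B y = (\<alpha> + i \<beta>) y\<close> with \<open>y k = 1\<close> an entry of maximal modulus, then
  \<open>u = 1 + \<eta> Re y\<close> is nonnegative, and bordering \<open>B\<close> with the column \<open>u\<close>, the row \<open>t e\<^sub>k\<close> and the
  corner \<open>a\<close> multiplies the characteristic polynomial by \<open>q(x) / ((x - \<rho>) ((x - \<alpha>)\<^sup>2 + \<beta>\<^sup>2))\<close>.\<close>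

section \<open>Characteristic polynomials as sums over permutations\<close>

lemma poly_char_poly_det:
  fixes A :: "'a :: comm_ring_1 mat"
  assumes "A \<in> carrier_mat n n"
  shows "poly (char_poly A) z = det (mat n n (\<lambda>(i, j). (if i = j then z else 0) - A $$ (i, j)))"
  unfolding char_poly_def
  by (rule poly_det_cong[of _ n]) (use assms in \<open>auto simp: char_poly_matrix_def\<close>)

text \<open>The Leibniz expansion reduces later claims about characteristic polynomials to single
  permutations: invariance under diagonal scaling, invariance under changes in an off-diagonal
  block, and continuity in the entries.\<close>

lemma poly_char_poly_sum_permutes:
  fixes A :: "'a :: comm_ring_1 mat"
  assumes "A \<in> carrier_mat n n"
  shows "poly (char_poly A) z =
    (\<Sum>p | p permutes {0..<n}. signof p * (\<Prod>i = 0..<n. (if i = p i then z else 0) - A $$ (i, p i)))"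
proof -
  have "(\<Prod>i = 0..<n. mat n n (\<lambda>(i, j). (if i = j then z else 0) - A $$ (i, j)) $$ (i, p i))
      = (\<Prod>i = 0..<n. (if i = p i then z else 0) - A $$ (i, p i))" if "p permutes {0..<n}" for p
    by (rule prod.cong) (use permutes_in_image[OF that] in auto)
  then show ?thesis
    unfolding poly_char_poly_det[OF assms] by (subst det_def'[of _ n]) auto
qed

text \<open>For each permutation \<open>p\<close> the scaling contributes the factor
  \<open>x (p i) / x i\<close> in every row \<open>i\<close>; these factors multiply to 1 because
  \<open>p\<close> only rearranges the indices. On the diagonal the factor is 1, so the entries
  involving \<open>z\<close> fit the same pattern.\<close>

lemma char_poly_diagonal_scaling:
  fixes A :: "'a :: field_char_0 mat"
  assumes A: "A \<in> carrier_mat n n" and x: "\<And>i. i < n \<Longrightarrow> x i \<noteq> 0"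
  shows "char_poly (mat n n (\<lambda>(i, j). A $$ (i, j) * x j / x i)) = char_poly A" (is "char_poly ?B = _")
proof -
  have B: "?B \<in> carrier_mat n n" by simp
  have "(\<Prod>i = 0..<n. (if i = p i then z else 0) - ?B $$ (i, p i))
      = (\<Prod>i = 0..<n. (if i = p i then z else 0) - A $$ (i, p i))" if p: "p permutes {0..<n}" for p z
  proof -
    have "(\<Prod>i = 0..<n. (if i = p i then z else 0) - ?B $$ (i, p i))
        = (\<Prod>i = 0..<n. ((if i = p i then z else 0) - A $$ (i, p i)) * (x (p i) / x i))"
      by (rule prod.cong) (use permutes_in_image[OF p] x in \<open>auto simp: field_simps\<close>)
    also have "\<dots> = (\<Prod>i = 0..<n. (if i = p i then z else 0) - A $$ (i, p i))
                  * ((\<Prod>i = 0..<n. x (p i)) / (\<Prod>i = 0..<n. x i))"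
      by (simp only: prod.distrib prod_dividef)
    also have "(\<Prod>i = 0..<n. x (p i)) = (\<Prod>i = 0..<n. x i)"
      using prod.permute[OF p, of x] by (simp add: o_def)
    also have "\<dots> / (\<Prod>i = 0..<n. x i) = 1" using x by (simp add: prod_zero_iff)
    finally show ?thesis by simp
  qed
  then have "poly (char_poly ?B) = poly (char_poly A)"
    unfolding fun_eq_iff poly_char_poly_sum_permutes[OF A] poly_char_poly_sum_permutes[OF B]
    by (auto intro!: sum.cong)
  then show ?thesis by (simp add: poly_eq_poly_eq_iff)
qed

section \<open>Compactness in finitely many real coordinates\<close>

text \<open>Bolzano-Weierstrass, one coordinate at a time: each new coordinate is made monotone
  along a further subsequence, and boundedness then gives convergence. Coordinates treated earlier
  stay convergent.\<close>

lemma convergent_subsequence_finite_family: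
  fixes f :: "nat \<Rightarrow> 'i \<Rightarrow> real"
  assumes "finite I" and "\<And>i. i \<in> I \<Longrightarrow> Bseq (\<lambda>k. f k i)"
  shows "\<exists>r :: nat \<Rightarrow> nat. strict_mono r \<and> (\<forall>i \<in> I. convergent (\<lambda>k. f (r k) i))"
  using assms
proof (induction I rule: finite_induct)
  case empty
  then show ?case by (auto intro: exI[of _ id] simp: strict_mono_def)
next
  case (insert i I)
  then obtain r :: "nat \<Rightarrow> nat" where r: "strict_mono r" "\<forall>i \<in> I. convergent (\<lambda>k. f (r k) i)" by auto
  obtain s :: "nat \<Rightarrow> nat" where s: "strict_mono s" "monoseq (\<lambda>k. f (r (s k)) i)"
    using seq_monosub[of "\<lambda>k. f (r k) i"] by auto
  have "Bseq (\<lambda>k. f (r (s k)) i)"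
    using insert.prems[of i] unfolding Bseq_def by auto
  then have "convergent (\<lambda>k. f (r (s k)) i)" using s(2) by (rule Bseq_monoseq_convergent)
  moreover have "convergent (\<lambda>k. f (r (s k)) j)" if "j \<in> I" for j
    using convergent_subseq_convergent[OF r(2)[rule_format, OF that] s(1)] by (simp add: o_def)
  ultimately show ?case
    using strict_mono_o[OF r(1) s(1)] by (auto intro!: exI[of _ "r \<circ> s"])
qed

section \<open>Spectral radius and positive subinvariant vectors\<close>

lemma spectral_radius_nonneg:
  assumes "A \<in> carrier_mat n n" and "n > 0"
  shows "0 \<le> spectral_radius A"
  using spectral_radius_mem_max(1)[OF assms] by auto

lemma norm_le_spectral_radius:
  assumes "A \<in> carrier_mat n n" and "n > 0" and "eigenvalue A k"
  shows "norm k \<le> spectral_radius A"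
  using spectral_radius_mem_max(2)[OF assms(1,2)] assms(3) by (auto simp: spectrum_def)

text \<open>The weights \<open>s ^ k\<close> make the truncated Neumann series of \<open>s \<cdot> C\<close> an almost invariant vector even
  though only boundedness of the powers of \<open>C\<close> is known.\<close>

lemma ex_positive_subinvariant_vector:
  fixes C :: "real mat"
  assumes C: "C \<in> carrier_mat n n" and nonneg: "\<And>i j. i < n \<Longrightarrow> j < n \<Longrightarrow> 0 \<le> C $$ (i, j)"
    and sr: "spectral_radius (map_mat complex_of_real C) < 1" and s: "0 < s" "s < 1"
  shows "\<exists>x. \<forall>i < n. 0 < x i \<and> s * (\<Sum>j = 0..<n. C $$ (i, j) * x j) \<le> x i"
proof -
  let ?Cc = "map_mat complex_of_real C"
  \<comment> \<open>\<open>g k\<close> is the vector \<open>C ^\<^sub>m k\<close> applied to the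
    all-ones vector.\<close>
  define g where "g k i = (\<Sum>j = 0..<n. (C ^\<^sub>m k) $$ (i, j))" for k i
  have Ck: "C ^\<^sub>m k \<in> carrier_mat n n" for k using C by simp
  have g0: "g 0 i = 1" if "i < n" for i
    using that C by (simp add: g_def if_distrib cong: if_cong)
  \<comment> \<open>Powers are defined by multiplication on the right, while the recursion for
    \<open>g\<close> needs the extra factor on the left.\<close>
  have comm: "C ^\<^sub>m Suc k = C * C ^\<^sub>m k" for k
  proof (induction k)
    case (Suc k)
    have "C ^\<^sub>m Suc (Suc k) = (C * C ^\<^sub>m k) * C" using Suc by simp
    also have "\<dots> = C * (C ^\<^sub>m k * C)" by (rule assoc_mult_mat[OF C Ck C])
    finally show ?case by simp
  qed (use C in simp)
  have gS: "g (Suc k) i = (\<Sum>j = 0..<n. C $$ (i, j) * g k j)" if "i < n" for k i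
  proof -
    have "g (Suc k) i = (\<Sum>l = 0..<n. (C * C ^\<^sub>m k) $$ (i, l))"
      unfolding g_def comm ..
    also have "\<dots> = (\<Sum>l = 0..<n. \<Sum>j = 0..<n. C $$ (i, j) * (C ^\<^sub>m k) $$ (j, l))"
      by (rule sum.cong) (use that C Ck[of k] in \<open>auto simp: scalar_prod_def\<close>)
    also have "\<dots> = (\<Sum>j = 0..<n. C $$ (i, j) * g k j)"
      unfolding g_def by (subst sum.swap) (simp add: sum_distrib_left)
    finally show ?thesis .
  qed
  have g_nonneg: "0 \<le> g k i" if "i < n" for k i
    using that
  proof (induction k arbitrary: i)
    case (Suc k)
    then show ?case by (auto simp: gS intro!: sum_nonneg mult_nonneg_nonneg nonneg)
  qed (simp add: g0)
  \<comment> \<open>This is where the spectral radius enters: below 1, it bounds the entries of all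
    powers by one constant.\<close>
  obtain b where b: "\<And>k. norm_bound (?Cc ^\<^sub>m k) b"
    using spectral_radius_jnf_norm_bound_less_1_upper_triangular[of ?Cc n] C sr by auto
  have g_le: "g k i \<le> real n * b" if "i < n" for k i
  proof -
    have "(C ^\<^sub>m k) $$ (i, j) \<le> b" if "j < n" for j
    proof -
      have "norm ((?Cc ^\<^sub>m k) $$ (i, j)) \<le> b"
        using b[of k] that \<open>i < n\<close> C unfolding norm_bound_def by auto
      also have "?Cc ^\<^sub>m k = map_mat complex_of_real (C ^\<^sub>m k)"
        by (rule of_real_hom.mat_hom_pow[OF C, symmetric])
      finally show ?thesis using that \<open>i < n\<close> C by (auto simp: abs_le_iff)
    qed
    then show ?thesis
      unfolding g_def using sum_bounded_above[of "{0..<n}" "\<lambda>j. (C ^\<^sub>m k) $$ (i, j)" b] by simp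
  qed
  have "(\<lambda>N. s ^ N * (real n * b)) \<longlonglongrightarrow> 0 * (real n * b)"
    using s by (intro tendsto_intros LIMSEQ_power_zero) auto
  then have "eventually (\<lambda>N. s ^ N * (real n * b) < 1) sequentially"
    by (rule order_tendstoD(2)) simp
  \<comment> \<open>\<open>N\<close> is so large that the last term of the telescoping sum below
    stays under \<open>g 0 i = 1\<close>; \<open>N > 0\<close> keeps the term for
    \<open>k = 0\<close> in the sum, which makes it positive.\<close>
  then obtain N where N: "s ^ N * (real n * b) < 1" "N > 0"
    using eventually_happens'[OF _ eventually_conj[OF _ eventually_gt_at_top[of 0]]] by force
  define x where "x i = (\<Sum>k<N. s ^ k * g k i)" for i
  have "0 < x i \<and> s * (\<Sum>j = 0..<n. C $$ (i, j) * x j) \<le> x i" if i: "i < n" for i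
  proof
    have "0 < s ^ 0 * g 0 i" using i by (simp add: g0)
    also have "\<dots> \<le> x i" unfolding x_def
      by (rule member_le_sum) (use N s g_nonneg[OF i] in auto)
    finally show "0 < x i" .
    have "s * (\<Sum>j = 0..<n. C $$ (i, j) * x j) = (\<Sum>k<N. s ^ Suc k * (\<Sum>j = 0..<n. C $$ (i, j) * g k j))"
      unfolding x_def sum_distrib_left by (subst sum.swap) (simp add: mult_ac)
    also have "\<dots> = (\<Sum>k<N. s ^ Suc k * g (Suc k) i)" using i by (simp add: gS)
    \<comment> \<open>Applying \<open>s\<close> times \<open>C\<close> shifts the truncated series
      by one index, so only the two boundary terms differ from \<open>x i\<close>.\<close>
    also have "\<dots> = x i + s ^ N * g N i - g 0 i"
      unfolding x_def using sum.lessThan_Suc_shift[of "\<lambda>k. s ^ k * g k i" N] by simp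
    also have "\<dots> \<le> x i"
    proof -
      have "s ^ N * g N i \<le> s ^ N * (real n * b)" using g_le[OF i] s by (intro mult_left_mono) auto
      then show ?thesis using N i by (simp add: g0)
    qed
    finally show "s * (\<Sum>j = 0..<n. C $$ (i, j) * x j) \<le> x i" .
  qed
  then show ?thesis by blast
qed

lemma eigenvalue_iff_sum:
  assumes A: "A \<in> carrier_mat n n"
  shows "eigenvalue A k \<longleftrightarrow>
    (\<exists>v. (\<exists>i < n. v i \<noteq> 0) \<and> (\<forall>i < n. (\<Sum>j = 0..<n. A $$ (i, j) * v j) = k * v i))"
    (is "_ \<longleftrightarrow> ?R")
proof
  assume "eigenvalue A k"
  then obtain v where v: "v \<in> carrier_vec n" "v \<noteq> 0\<^sub>v n" "A *\<^sub>v v = k \<cdot>\<^sub>v v"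
    using A unfolding eigenvalue_def eigenvector_def by auto
  have "(\<Sum>j = 0..<n. A $$ (i, j) * v $ j) = k * v $ i" if "i < n" for i
  proof -
    have "(A *\<^sub>v v) $ i = k * v $ i" using that v by simp
    then show ?thesis using that v(1) A by (simp add: scalar_prod_def)
  qed
  moreover have "\<exists>i < n. v $ i \<noteq> 0" using v(1,2) by (auto intro!: eq_vecI)
  ultimately show ?R by (intro exI[of _ "\<lambda>i. v $ i"]) auto
next
  assume ?R
  then obtain v i where v: "i < n" "v i \<noteq> 0"
    "\<And>i. i < n \<Longrightarrow> (\<Sum>j = 0..<n. A $$ (i, j) * v j) = k * v i" by auto
  have "vec n v \<noteq> 0\<^sub>v n" using v(1,2) by (metis index_vec index_zero_vec(1))
  moreover have "A *\<^sub>v vec n v = k \<cdot>\<^sub>v vec n v"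
    by (rule eq_vecI) (use A v(3) in \<open>auto simp: scalar_prod_def\<close>)
  ultimately show "eigenvalue A k"
    using A unfolding eigenvalue_def eigenvector_def by (intro exI[of _ "vec n v"]) auto
qed

section \<open>Row sums bounded by the spectral radius\<close>

text \<open>Dividing by \<open>c = \<rho> + e\<close> pushes the spectral radius below 1, so a
  positive \<open>x\<close> with \<open>C x \<le> (1 + e) x\<close> exists. Scaling \<open>A\<close>
  diagonally by \<open>x\<close> turns this vector inequality into a bound on row sums: row
  \<open>i\<close> sums to \<open>c\<close> times the quotient of the \<open>i\<close>-th entry of
  \<open>C x\<close> by \<open>x i\<close>.\<close>

lemma ex_similar_row_sums_le:
  fixes A :: "real mat"
  assumes A: "A \<in> carrier_mat n n" and nonneg: "\<And>i j. i < n \<Longrightarrow> j < n \<Longrightarrow> 0 \<le> A $$ (i, j)"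
    and n: "n > 0" and e: "e > 0"
  defines "\<rho> \<equiv> spectral_radius (map_mat complex_of_real A)"
  shows "\<exists>B \<in> carrier_mat n n. (\<forall>i < n. \<forall>j < n. 0 \<le> B $$ (i, j)) \<and> char_poly B = char_poly A \<and>
           (\<forall>i < n. (\<Sum>j = 0..<n. B $$ (i, j)) \<le> (\<rho> + e) * (1 + e))"
proof -
  have Ac: "map_mat complex_of_real A \<in> carrier_mat n n" using A by simp
  define c where "c = \<rho> + e"
  have \<rho>: "0 \<le> \<rho>" unfolding \<rho>_def by (rule spectral_radius_nonneg[OF Ac n])
  then have c: "c > 0" using e unfolding c_def by simp
  define C where "C = mat n n (\<lambda>(i, j). A $$ (i, j) / c)"
  have C: "C \<in> carrier_mat n n" and Cc: "map_mat complex_of_real C \<in> carrier_mat n n"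
    unfolding C_def by simp_all
  \<comment> \<open>An eigenvalue \<open>k\<close> of \<open>C\<close> of maximal modulus gives the
    eigenvalue \<open>c * k\<close> of \<open>A\<close>, so \<open>c\<close> times its modulus is at
    most \<open>\<rho>\<close>, hence below \<open>c\<close>.\<close>
  have "spectral_radius (map_mat complex_of_real C) < 1"
  proof -
    obtain k where k: "eigenvalue (map_mat complex_of_real C) k"
      "norm k = spectral_radius (map_mat complex_of_real C)"
      using spectral_radius_mem_max(1)[OF Cc n] by (auto simp: spectrum_def)
    then obtain v where "\<exists>i < n. v i \<noteq> 0"
      and v: "\<And>i. i < n \<Longrightarrow> (\<Sum>j = 0..<n. map_mat complex_of_real C $$ (i, j) * v j) = k * v i"
      unfolding eigenvalue_iff_sum[OF Cc] by auto
    moreover have "(\<Sum>j = 0..<n. map_mat complex_of_real A $$ (i, j) * v j) = (of_real c * k) * v i"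
      if "i < n" for i
    proof -
      have "(\<Sum>j = 0..<n. map_mat complex_of_real A $$ (i, j) * v j)
          = of_real c * (\<Sum>j = 0..<n. map_mat complex_of_real C $$ (i, j) * v j)"
        unfolding sum_distrib_left
        by (rule sum.cong) (use that A c in \<open>auto simp: C_def\<close>)
      then show ?thesis using v[OF that] by simp
    qed
    ultimately have "eigenvalue (map_mat complex_of_real A) (of_real c * k)"
      unfolding eigenvalue_iff_sum[OF Ac] by blast
    from norm_le_spectral_radius[OF Ac n this] have "c * norm k \<le> \<rho>"
      using c by (simp add: norm_mult \<rho>_def)
    also have "\<rho> < c * 1" using e by (simp add: c_def)
    finally show ?thesis using c k(2) by (simp only: mult_less_cancel_left_pos)
  qed
  then obtain x where x: "\<And>i. i < n \<Longrightarrow> 0 < x i"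
    and sub: "\<And>i. i < n \<Longrightarrow> inverse (1 + e) * (\<Sum>j = 0..<n. C $$ (i, j) * x j) \<le> x i"
    using ex_positive_subinvariant_vector[OF C, of "inverse (1 + e)"] nonneg c e
    by (auto simp: C_def inverse_less_1_iff)
  define B where "B = mat n n (\<lambda>(i, j). A $$ (i, j) * x j / x i)"
  have "char_poly B = char_poly A"
    unfolding B_def by (rule char_poly_diagonal_scaling[OF A]) (use x in force)
  moreover have "0 \<le> B $$ (i, j)" if "i < n" "j < n" for i j
    using that nonneg[OF that] x[of i] x[of j] by (simp add: B_def)
  moreover have "(\<Sum>j = 0..<n. B $$ (i, j)) \<le> (\<rho> + e) * (1 + e)" if i: "i < n" for i
  proof -
    have "(\<Sum>j = 0..<n. B $$ (i, j)) = c * (\<Sum>j = 0..<n. C $$ (i, j) * x j) / x i"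
      using i c by (simp add: B_def C_def sum_distrib_left sum_divide_distrib)
    also have "\<dots> \<le> c * ((1 + e) * x i) / x i"
      using sub[OF i] x[OF i] c e
      by (intro divide_right_mono mult_left_mono) (auto simp: field_simps)
    also have "\<dots> = (\<rho> + e) * (1 + e)" using x[OF i] by (simp add: c_def)
    finally show ?thesis .
  qed
  ultimately show ?thesis by (intro bexI[of _ B]) (auto simp: B_def)
qed

text \<open>At a fixed \<open>z\<close> the value is a finite sum of finite products of affine
  functions of the entries.\<close>

lemma tendsto_poly_char_poly:
  fixes F :: "nat \<Rightarrow> real mat"
  assumes F: "\<And>k. F k \<in> carrier_mat n n" and B: "B \<in> carrier_mat n n"
    and lim: "\<And>i j. i < n \<Longrightarrow> j < n \<Longrightarrow> (\<lambda>k. F k $$ (i, j)) \<longlonglongrightarrow> B $$ (i, j)"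
  shows "(\<lambda>k. poly (char_poly (F k)) z) \<longlonglongrightarrow> poly (char_poly B) z"
  unfolding poly_char_poly_sum_permutes[OF F] poly_char_poly_sum_permutes[OF B]
  by (intro tendsto_sum tendsto_mult tendsto_const tendsto_prod tendsto_diff lim)
    (auto simp: permutes_in_image)

text \<open>The scaled matrices for \<open>e k\<close> tending to 0 lie in a bounded set, so a
  subsequence converges entrywise. The scalings themselves may diverge, and the limit need not be
  similar to \<open>A\<close>; the characteristic polynomial survives because it is constant along
  the sequence and continuous in the entries.\<close>

lemma ex_row_sums_le_spectral_radius:
  fixes A :: "real mat"
  assumes A: "A \<in> carrier_mat n n" and nonneg: "\<And>i j. i < n \<Longrightarrow> j < n \<Longrightarrow> 0 \<le> A $$ (i, j)"
    and n: "n > 0"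
  defines "\<rho> \<equiv> spectral_radius (map_mat complex_of_real A)"
  shows "\<exists>B \<in> carrier_mat n n. (\<forall>i < n. \<forall>j < n. 0 \<le> B $$ (i, j)) \<and> char_poly B = char_poly A \<and>
           (\<forall>i < n. (\<Sum>j = 0..<n. B $$ (i, j)) \<le> \<rho>)"
proof -
  define e where "e k = inverse (real (Suc k))" for k
  have e: "0 < e k" "e k \<le> 1" for k
    by (auto simp: e_def inverse_le_1_iff)
  have "\<forall>k. \<exists>B. B \<in> carrier_mat n n \<and> (\<forall>i < n. \<forall>j < n. 0 \<le> B $$ (i, j)) \<and> char_poly B = char_poly A \<and>
           (\<forall>i < n. (\<Sum>j = 0..<n. B $$ (i, j)) \<le> (\<rho> + e k) * (1 + e k))"
    unfolding \<rho>_def using ex_similar_row_sums_le[OF A nonneg n e(1)] by (simp add: Bex_def)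
  then obtain F where F: "\<And>k. F k \<in> carrier_mat n n"
      "\<And>k i j. i < n \<Longrightarrow> j < n \<Longrightarrow> 0 \<le> F k $$ (i, j)" "\<And>k. char_poly (F k) = char_poly A"
      "\<And>k i. i < n \<Longrightarrow> (\<Sum>j = 0..<n. F k $$ (i, j)) \<le> (\<rho> + e k) * (1 + e k)"
    by metis
  have \<rho>: "0 \<le> \<rho>" unfolding \<rho>_def by (rule spectral_radius_nonneg[of _ n]) (use A n in auto)
  \<comment> \<open>By nonnegativity an entry is at most its row sum, and \<open>e k \<le> 1\<close>
    makes the bound on row sums uniform in \<open>k\<close>.\<close>
  have "Bseq (\<lambda>k. F k $$ ij)" if "ij \<in> {0..<n} \<times> {0..<n}" for ij
  proof (rule BseqI')
    fix k
    obtain i j where ij: "ij = (i, j)" "i < n" "j < n" using \<open>ij \<in> {0..<n} \<times> {0..<n}\<close> by auto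
    have "F k $$ (i, j) \<le> (\<Sum>j = 0..<n. F k $$ (i, j))"
      by (rule member_le_sum) (use F(2) ij in auto)
    also have "\<dots> \<le> (\<rho> + e k) * (1 + e k)" by (rule F(4)[OF ij(2)])
    also have "\<dots> \<le> (\<rho> + 1) * (1 + 1)" using e[of k] \<rho> by (intro mult_mono) auto
    finally show "norm (F k $$ ij) \<le> (\<rho> + 1) * (1 + 1)" using F(2)[OF ij(2,3), of k] ij by simp
  qed
  then obtain r :: "nat \<Rightarrow> nat" where r: "strict_mono r"
      "\<And>ij. ij \<in> {0..<n} \<times> {0..<n} \<Longrightarrow> convergent (\<lambda>k. F (r k) $$ ij)"
    using convergent_subsequence_finite_family[of "{0..<n} \<times> {0..<n}" "\<lambda>k ij. F k $$ ij"] by auto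
  define B where "B = mat n n (\<lambda>ij. lim (\<lambda>k. F (r k) $$ ij))"
  have B: "B \<in> carrier_mat n n" by (simp add: B_def)
  have lim: "(\<lambda>k. F (r k) $$ (i, j)) \<longlonglongrightarrow> B $$ (i, j)" if "i < n" "j < n" for i j
    using r(2)[of "(i, j)"] that by (simp add: B_def convergent_LIMSEQ_iff)
  have "poly (char_poly B) z = poly (char_poly A) z" for z
    using tendsto_poly_char_poly[of "\<lambda>k. F (r k)", OF F(1) B lim, of z]
    by (simp add: F(3) LIMSEQ_const_iff)
  then have "char_poly B = char_poly A" by (simp add: poly_eq_poly_eq_iff[symmetric] fun_eq_iff)
  moreover have "0 \<le> B $$ (i, j)" if "i < n" "j < n" for i j
    by (rule LIMSEQ_le_const[OF lim[OF that]]) (use F(2) that in auto)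
  moreover have "(\<Sum>j = 0..<n. B $$ (i, j)) \<le> \<rho>" if i: "i < n" for i
  proof -
    have "(\<lambda>k. e (r k)) \<longlonglongrightarrow> 0"
      using LIMSEQ_subseq_LIMSEQ[OF LIMSEQ_inverse_real_of_nat r(1)] by (simp add: e_def o_def)
    then have "(\<lambda>k. (\<rho> + e (r k)) * (1 + e (r k))) \<longlonglongrightarrow> (\<rho> + 0) * (1 + 0)"
      by (intro tendsto_intros)
    moreover have "(\<lambda>k. \<Sum>j = 0..<n. F (r k) $$ (i, j)) \<longlonglongrightarrow> (\<Sum>j = 0..<n. B $$ (i, j))"
      by (rule tendsto_sum) (use lim i in auto)
    ultimately show ?thesis
      using F(4)[OF i] LIMSEQ_le[of _ "\<Sum>j = 0..<n. B $$ (i, j)" _ "(\<rho> + 0) * (1 + 0)"] by simp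
  qed
  ultimately show ?thesis using B by blast
qed

section \<open>Filling row sums without changing the spectrum\<close>

text \<open>\<open>A\<close> and \<open>B\<close> may differ only in rows outside \<open>T\<close>
  and columns inside \<open>T\<close>. A permutation mapping \<open>T\<close> into itself is a
  bijection of \<open>T\<close> and never meets these positions. Any other permutation sends some
  index of \<open>T\<close> outside \<open>T\<close>, meets an off-diagonal zero there, and
  contributes 0 for both matrices.\<close>

lemma char_poly_eq_block_triangular:
  fixes A B :: "real mat"
  assumes A: "A \<in> carrier_mat n n" and B: "B \<in> carrier_mat n n" and T: "T \<subseteq> {0..<n}"
    and zero: "\<And>i j. i \<in> T \<Longrightarrow> j < n \<Longrightarrow> j \<notin> T \<Longrightarrow> A $$ (i, j) = 0"
    and eq: "\<And>i j. i < n \<Longrightarrow> j < n \<Longrightarrow> i \<in> T \<or> j \<notin> T \<Longrightarrow> B $$ (i, j) = A $$ (i, j)"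
  shows "char_poly B = char_poly A"
proof -
  have "(\<Prod>i = 0..<n. (if i = p i then z else 0) - B $$ (i, p i))
      = (\<Prod>i = 0..<n. (if i = p i then z else 0) - A $$ (i, p i))" if p: "p permutes {0..<n}" for p z
  proof (cases "p ` T \<subseteq> T")
    case True
    have "p ` T = T"
      using True T finite_subset[OF T] inj_on_subset[OF permutes_inj_on[OF p]]
      by (intro endo_inj_surj) auto
    then have "i \<in> T \<or> p i \<notin> T" if "i < n" for i
      using permutes_inj[OF p] by (auto simp: inj_def)
    moreover have "p i < n" if "i < n" for i using permutes_in_image[OF p, of i] that by simp
    ultimately show ?thesis by (intro prod.cong) (auto simp: eq)
  next
    case False
    then obtain i where i: "i \<in> T" "p i \<notin> T" by auto
    then have "i < n" "i \<noteq> p i" using T by auto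
    moreover have "p i < n" using permutes_in_image[OF p, of i] \<open>i < n\<close> by simp
    ultimately have "\<exists>i \<in> {0..<n}. (if i = p i then z else 0) - A $$ (i, p i) = 0"
        "\<exists>i \<in> {0..<n}. (if i = p i then z else 0) - B $$ (i, p i) = 0"
      using zero[of i "p i"] eq[of i "p i"] i by (auto intro!: bexI[of _ i])
    then show ?thesis by (simp add: prod_zero)
  qed
  then have "poly (char_poly B) = poly (char_poly A)"
    unfolding fun_eq_iff poly_char_poly_sum_permutes[OF A] poly_char_poly_sum_permutes[OF B]
    by (auto intro!: sum.cong)
  then show ?thesis by (simp add: poly_eq_poly_eq_iff)
qed

text \<open>The rows on which an eigenvector for \<open>\<rho>\<close> has maximal modulus already have sum \<open>\<rho>\<close> and are
  supported on the same index set \<open>T\<close>. The matrix is thus block triangular, and the deficits of the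
  other rows can be filled in a column of \<open>T\<close>, outside the diagonal blocks.\<close>

lemma ex_constant_row_sums:
  fixes A :: "real mat"
  assumes A: "A \<in> carrier_mat n n" and nonneg: "\<And>i j. i < n \<Longrightarrow> j < n \<Longrightarrow> 0 \<le> A $$ (i, j)"
    and le: "\<And>i. i < n \<Longrightarrow> (\<Sum>j = 0..<n. A $$ (i, j)) \<le> \<rho>" and \<rho>: "\<rho> > 0" and ev: "eigenvalue A \<rho>"
  shows "\<exists>B \<in> carrier_mat n n. (\<forall>i < n. \<forall>j < n. 0 \<le> B $$ (i, j)) \<and> char_poly B = char_poly A \<and>
           (\<forall>i < n. (\<Sum>j = 0..<n. B $$ (i, j)) = \<rho>)"
proof -
  obtain v k where k: "k < n" "v k \<noteq> 0"
    and v: "\<And>i. i < n \<Longrightarrow> (\<Sum>j = 0..<n. A $$ (i, j) * v j) = \<rho> * v i"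
    using ev unfolding eigenvalue_iff_sum[OF A] by auto
  define M where "M = Max ((\<lambda>i. \<bar>v i\<bar>) ` {0..<n})"
  have M_ge: "\<bar>v i\<bar> \<le> M" if "i < n" for i using that unfolding M_def by (intro Max_ge) auto
  have "M \<in> (\<lambda>i. \<bar>v i\<bar>) ` {0..<n}" unfolding M_def by (rule Max_in) (use k in auto)
  then obtain i0 where i0: "i0 < n" "\<bar>v i0\<bar> = M" by auto
  have M: "M > 0" using M_ge[OF k(1)] k(2) by linarith
  define T where "T = {i. i < n \<and> \<bar>v i\<bar> = M}"
  have T: "(\<Sum>j = 0..<n. A $$ (i, j)) = \<rho> \<and> (\<forall>j < n. j \<notin> T \<longrightarrow> A $$ (i, j) = 0)" if "i \<in> T" for i
  proof
    have i: "i < n" "\<bar>v i\<bar> = M" using that by (auto simp: T_def)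
    \<comment> \<open>The chain from \<open>\<rho> * M\<close> through the sum weighted by the
      moduli to \<open>M\<close> times the row sum, which is at most \<open>\<rho> * M\<close>,
      closes up, so equality holds throughout. The last equality fixes the row sum; the middle one
      forces \<open>A $$ (i, j) = 0\<close> wherever \<open>\<bar>v j\<bar> < M\<close>.\<close>
    have "\<rho> * M = \<bar>\<Sum>j = 0..<n. A $$ (i, j) * v j\<bar>" using v[OF i(1)] i(2) \<rho> by (simp add: abs_mult)
    also have "\<dots> \<le> (\<Sum>j = 0..<n. A $$ (i, j) * \<bar>v j\<bar>)"
      by (rule order_trans[OF sum_abs]) (use nonneg i in \<open>auto simp: abs_mult intro!: sum_mono\<close>)
    finally have 1: "\<rho> * M \<le> (\<Sum>j = 0..<n. A $$ (i, j) * \<bar>v j\<bar>)" .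
    have 2: "(\<Sum>j = 0..<n. A $$ (i, j)) * M \<le> \<rho> * M" using le[OF i(1)] M by simp
    have 3: "(\<Sum>j = 0..<n. A $$ (i, j) * (M - \<bar>v j\<bar>))
        = (\<Sum>j = 0..<n. A $$ (i, j)) * M - (\<Sum>j = 0..<n. A $$ (i, j) * \<bar>v j\<bar>)"
      by (simp add: right_diff_distrib sum_subtractf sum_distrib_right)
    have nn: "\<forall>j \<in> {0..<n}. 0 \<le> A $$ (i, j) * (M - \<bar>v j\<bar>)" using nonneg i M_ge by auto
    then have 4: "0 \<le> (\<Sum>j = 0..<n. A $$ (i, j) * (M - \<bar>v j\<bar>))" by (intro sum_nonneg) auto
    have "(\<Sum>j = 0..<n. A $$ (i, j)) * M = \<rho> * M" using 1 2 3 4 by linarith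
    then show "(\<Sum>j = 0..<n. A $$ (i, j)) = \<rho>" using M by simp
    have "(\<Sum>j = 0..<n. A $$ (i, j) * (M - \<bar>v j\<bar>)) = 0" using 1 2 3 4 by linarith
    then have "\<forall>j \<in> {0..<n}. A $$ (i, j) * (M - \<bar>v j\<bar>) = 0"
      using nn by (subst (asm) sum_nonneg_eq_0_iff) auto
    then show "\<forall>j < n. j \<notin> T \<longrightarrow> A $$ (i, j) = 0" by (auto simp: T_def)
  qed
  define B where "B = mat n n (\<lambda>(i, j).
    A $$ (i, j) + (if i \<notin> T \<and> j = i0 then \<rho> - (\<Sum>l = 0..<n. A $$ (i, l)) else 0))"
  have i0T: "i0 \<in> T" using i0 by (simp add: T_def)
  have B: "B \<in> carrier_mat n n" by (simp add: B_def)
  have "char_poly B = char_poly A"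
    by (rule char_poly_eq_block_triangular[OF A B, of T]) (use T i0T in \<open>auto simp: B_def T_def\<close>)
  moreover have "0 \<le> B $$ (i, j)" if "i < n" "j < n" for i j
    using that nonneg[OF that] le[OF that(1)] by (simp add: B_def)
  moreover have "(\<Sum>j = 0..<n. B $$ (i, j)) = \<rho>" if i: "i < n" for i
  proof (cases "i \<in> T")
    case True
    then show ?thesis using i T[OF True] by (simp add: B_def)
  next
    case False
    then show ?thesis using i i0 by (simp add: B_def sum.distrib)
  qed
  ultimately show ?thesis using B by blast
qed

section \<open>Bordered matrices and their characteristic polynomials\<close>

definition bordered_mat :: "'a mat \<Rightarrow> (nat \<Rightarrow> 'a) \<Rightarrow> (nat \<Rightarrow> 'a) \<Rightarrow> 'a \<Rightarrow> 'a :: zero mat" where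
  "bordered_mat B u v a = four_block_mat B (mat (dim_row B) 1 (\<lambda>(i, _). u i))
     (mat 1 (dim_col B) (\<lambda>(_, j). v j)) (mat 1 1 (\<lambda>_. a))"

lemma bordered_mat_carrier [simp]:
  "B \<in> carrier_mat n n \<Longrightarrow> bordered_mat B u v a \<in> carrier_mat (Suc n) (Suc n)"
  unfolding bordered_mat_def by auto

text \<open>A Schur complement computation in which a solution \<open>w\<close> of
  \<open>(z - B) w = u\<close> replaces the inverse of \<open>z - B\<close>. Multiplying on the
  right by the unit triangular matrix with last column built from \<open>w\<close> clears the border
  column and leaves the second factor in the corner.\<close>

lemma poly_char_poly_bordered_mat:
  fixes B :: "'a :: idom mat"
  assumes B: "B \<in> carrier_mat n n"
    and w: "\<And>i. i < n \<Longrightarrow> z * w i - (\<Sum>j = 0..<n. B $$ (i, j) * w j) = u i"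
  shows "poly (char_poly (bordered_mat B u v a)) z
    = poly (char_poly B) z * (z - a - (\<Sum>j = 0..<n. v j * w j))"
proof -
  let ?M = "bordered_mat B u v a"
  define K where "K = mat n n (\<lambda>(i, j). (if i = j then z else 0) - B $$ (i, j))"
  define R where "R = four_block_mat (1\<^sub>m n) (mat n 1 (\<lambda>(i, _). w i)) (0\<^sub>m 1 n) (1\<^sub>m 1)"
  define L where "L = four_block_mat K (mat n 1 (\<lambda>(i, _). - u i)) (mat 1 n (\<lambda>(_, j). - v j)) (mat 1 1 (\<lambda>_. z - a))"
  have K: "K \<in> carrier_mat n n" by (simp add: K_def)
  have R: "R \<in> carrier_mat (Suc n) (Suc n)" and L: "L \<in> carrier_mat (Suc n) (Suc n)"
    unfolding R_def L_def using K by auto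
  have M: "?M \<in> carrier_mat (Suc n) (Suc n)" using B by simp
  have "mat (Suc n) (Suc n) (\<lambda>(i, j). (if i = j then z else 0) - ?M $$ (i, j)) = L"
    by (rule eq_matI) (use B in \<open>auto simp: L_def K_def bordered_mat_def\<close>)
  then have 1: "poly (char_poly ?M) z = det L" using poly_char_poly_det[OF M] by simp
  have Kw: "(\<Sum>j = 0..<n. K $$ (i, j) * w j) = u i" if "i < n" for i
  proof -
    have "(\<Sum>j = 0..<n. K $$ (i, j) * w j)
        = (\<Sum>j = 0..<n. (if i = j then z * w j else 0) - B $$ (i, j) * w j)"
      by (rule sum.cong) (use that in \<open>auto simp: K_def algebra_simps\<close>)
    also have "\<dots> = u i" using that w[OF that] by (simp add: sum_subtractf)
    finally show ?thesis .
  qed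
  have "L * R = four_block_mat K (0\<^sub>m n 1) (mat 1 n (\<lambda>(_, j). - v j))
      (mat 1 1 (\<lambda>_. z - a - (\<Sum>j = 0..<n. v j * w j)))"
    unfolding L_def R_def
    by (subst mult_four_block_mat[OF K])
      (use K Kw in \<open>auto intro!: cong_four_block_mat eq_matI simp: scalar_prod_def sum_negf\<close>)
  then have "det (L * R) = det K * (z - a - (\<Sum>j = 0..<n. v j * w j))"
    by (simp add: det_four_block_mat_upper_right_zero[OF K refl] det_single)
  moreover have "det R = 1"
    unfolding R_def by (subst det_four_block_mat_lower_left_zero[of _ n _ 1]) auto
  moreover have "det K = poly (char_poly B) z"
    unfolding K_def by (rule poly_char_poly_det[OF B, symmetric])
  ultimately show ?thesis using 1 det_mult[OF L R] by simp
qed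

lemma poly_map_q_poly:
  "poly (map_poly complex_of_real (q_poly \<rho> \<alpha> \<beta> a t \<eta>)) z =
     (z - of_real \<rho>) * ((z - of_real \<alpha>)\<^sup>2 + (of_real \<beta>)\<^sup>2) * (z - of_real a)
     - of_real t * ((z - of_real \<alpha>) * ((1 + of_real \<eta>) * z - of_real \<alpha> - of_real \<eta> * of_real \<rho>)
       + (of_real \<beta>)\<^sup>2)"
  by (simp add: q_poly_def power2_eq_square map_poly_pCons algebra_simps)

text \<open>The vector \<open>w\<close> below is \<open>(z - B)\<inverse> u = 1 / (z - \<rho>) + (\<eta> / 2) (y / (z - \<xi>) + cnj y / (z - cnj \<xi>))\<close>;
  its entry at \<open>k\<close> supplies the partial fraction decomposition of the term with factor \<open>t\<close> in \<open>q\<close>.\<close>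

lemma ex_bordered_realisation:
  fixes B :: "real mat" and \<alpha> \<beta> :: real
  defines "\<xi> \<equiv> Complex \<alpha> \<beta>"
  assumes B: "B \<in> carrier_mat n n" and nonneg: "\<And>i j. i < n \<Longrightarrow> j < n \<Longrightarrow> 0 \<le> B $$ (i, j)"
    and sums: "\<And>i. i < n \<Longrightarrow> (\<Sum>j = 0..<n. B $$ (i, j)) = \<rho>"
    and ev: "eigenvalue (map_mat complex_of_real B) \<xi>"
    and a: "0 \<le> a" and t: "0 \<le> t" and \<eta>: "0 \<le> \<eta>" "\<eta> \<le> 1"
  shows "\<exists>M \<in> carrier_mat (Suc n) (Suc n). (\<forall>i < Suc n. \<forall>j < Suc n. 0 \<le> M $$ (i, j)) \<and>
    char_poly (map_mat complex_of_real M) * ([:-of_real \<rho>, 1:] * [:-\<xi>, 1:] * [:-cnj \<xi>, 1:])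
      = char_poly (map_mat complex_of_real B) * map_poly complex_of_real (q_poly \<rho> \<alpha> \<beta> a t \<eta>)"
proof -
  let ?Bc = "map_mat complex_of_real B" and ?q = "map_poly complex_of_real (q_poly \<rho> \<alpha> \<beta> a t \<eta>)"
  let ?c = "[:-of_real \<rho>, 1:] * [:-\<xi>, 1:] * [:-cnj \<xi>, 1:] :: complex poly"
  have Bc: "?Bc \<in> carrier_mat n n" using B by simp
  obtain x l where l: "l < n" "x l \<noteq> 0"
    and x: "\<And>i. i < n \<Longrightarrow> (\<Sum>j = 0..<n. ?Bc $$ (i, j) * x j) = \<xi> * x i"
    using ev unfolding eigenvalue_iff_sum[OF Bc] by auto
  define N where "N = Max ((\<lambda>i. cmod (x i)) ` {0..<n})"
  have N_ge: "cmod (x i) \<le> N" if "i < n" for i using that unfolding N_def by (intro Max_ge) auto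
  have "N \<in> (\<lambda>i. cmod (x i)) ` {0..<n}" unfolding N_def by (rule Max_in) (use l in auto)
  then obtain k where k: "k < n" "cmod (x k) = N" by auto
  have N: "N > 0" using N_ge[OF l(1)] l(2) by (metis norm_le_zero_iff not_less order_trans)
  define y where "y i = x i / x k" for i
  have xk: "x k \<noteq> 0" using N k by auto
  have yk: "y k = 1" using xk by (simp add: y_def)
  have y_le: "cmod (y i) \<le> 1" if "i < n" for i
    using N_ge[OF that] N k by (simp add: y_def norm_divide)
  have y: "(\<Sum>j = 0..<n. of_real (B $$ (i, j)) * y j) = \<xi> * y i" if "i < n" for i
  proof -
    have "(\<Sum>j = 0..<n. of_real (B $$ (i, j)) * y j) = (\<Sum>j = 0..<n. ?Bc $$ (i, j) * x j) / x k"
      unfolding sum_divide_distrib by (rule sum.cong) (use that B in \<open>auto simp: y_def\<close>)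
    then show ?thesis using x[OF that] by (simp add: y_def)
  qed
  \<comment> \<open>\<open>B\<close> is real, so conjugation carries the eigenvector equation for
    \<open>\<xi>\<close> to one for \<open>cnj \<xi>\<close>.\<close>
  have cnj_y: "(\<Sum>j = 0..<n. of_real (B $$ (i, j)) * cnj (y j)) = cnj \<xi> * cnj (y i)" if "i < n" for i
    using arg_cong[OF y[OF that], of cnj] by simp
  have one: "(\<Sum>j = 0..<n. complex_of_real (B $$ (i, j))) = of_real \<rho>" if "i < n" for i
    using sums[OF that] by (simp flip: of_real_sum)
  define u where "u i = 1 + \<eta> * Re (y i)" for i
  define v where "v j = (if j = k then t else 0)" for j
  define M where "M = bordered_mat B u v a"
  have M: "M \<in> carrier_mat (Suc n) (Suc n)" using B by (simp add: M_def)
  have u: "0 \<le> u i" if "i < n" for i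
  proof -
    have "\<bar>\<eta> * Re (y i)\<bar> \<le> 1 * 1"
      unfolding abs_mult using \<eta> y_le[OF that] abs_Re_le_cmod[of "y i"] by (intro mult_mono) auto
    then show ?thesis unfolding u_def by linarith
  qed
  have M_nonneg: "0 \<le> M $$ (i, j)" if "i < Suc n" "j < Suc n" for i j
    using that B u nonneg t a by (auto simp: M_def bordered_mat_def v_def)
  have Mc: "map_mat complex_of_real M = bordered_mat ?Bc (\<lambda>i. of_real (u i)) (\<lambda>j. of_real (v j)) (of_real a)"
    by (rule eq_matI) (use B in \<open>auto simp: M_def bordered_mat_def\<close>)
  have c: "poly ?c z = (z - of_real \<rho>) * (z - \<xi>) * (z - cnj \<xi>)" for z unfolding poly_mult by simp
  \<comment> \<open>The extra factor \<open>?c\<close> makes both sides vanish at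
    \<open>\<rho>\<close>, \<open>\<xi>\<close> and \<open>cnj \<xi>\<close>, where the partial
    fractions have poles. The identity then holds at every \<open>z\<close>, and the factor is
    cancelled as a nonzero polynomial.\<close>
  have "poly (char_poly (map_mat complex_of_real M) * ?c * ?c) z = poly (char_poly ?Bc * ?q * ?c) z" for z
  proof (cases "z = of_real \<rho> \<or> z = \<xi> \<or> z = cnj \<xi>")
    case True
    then have "poly ?c z = 0" unfolding c by auto
    then show ?thesis by (simp only: poly_mult mult_zero_right)
  next
    case False
    then have z: "z - of_real \<rho> \<noteq> 0" "z - \<xi> \<noteq> 0" "z - cnj \<xi> \<noteq> 0" by auto
    have cancel: "c \<noteq> 0 \<Longrightarrow> c * (d / c) = d" for c d :: complex by simp
    \<comment> \<open>\<open>P\<close>, \<open>Q\<close> and \<open>S\<close> are the coefficients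
      of the all-ones vector, \<open>y\<close> and \<open>cnj y\<close> in \<open>w\<close>. The
      halves come from \<open>Re y = (y + cnj y) / 2\<close>. Later algebra uses the products
      \<open>PQS\<close> and so avoids division by the linear factors.\<close>
    define P where "P = 1 / (z - of_real \<rho>)"
    define Q where "Q = of_real \<eta> / 2 / (z - \<xi>)"
    define S where "S = of_real \<eta> / 2 / (z - cnj \<xi>)"
    have PQS: "(z - of_real \<rho>) * P = 1" "(z - \<xi>) * Q = of_real \<eta> / 2" "(z - cnj \<xi>) * S = of_real \<eta> / 2"
      unfolding P_def Q_def S_def by (rule cancel, rule z)+
    define w where "w i = P + Q * y i + S * cnj (y i)" for i
    have w: "z * w i - (\<Sum>j = 0..<n. ?Bc $$ (i, j) * w j) = of_real (u i)" if i: "i < n" for i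
    proof -
      have "(\<Sum>j = 0..<n. ?Bc $$ (i, j) * w j)
          = (\<Sum>j = 0..<n. P * of_real (B $$ (i, j)) + Q * (of_real (B $$ (i, j)) * y j)
              + S * (of_real (B $$ (i, j)) * cnj (y j)))"
        by (rule sum.cong) (use i B in \<open>auto simp: w_def algebra_simps\<close>)
      also have "\<dots> = P * of_real \<rho> + Q * (\<xi> * y i) + S * (cnj \<xi> * cnj (y i))"
        using one[OF i] y[OF i] cnj_y[OF i] by (simp add: sum.distrib flip: sum_distrib_left)
      finally have "z * w i - (\<Sum>j = 0..<n. ?Bc $$ (i, j) * w j)
          = (z - of_real \<rho>) * P + ((z - \<xi>) * Q) * y i + ((z - cnj \<xi>) * S) * cnj (y i)"
        by (simp add: w_def algebra_simps)
      also have "\<dots> = 1 + of_real \<eta> / 2 * (y i + cnj (y i))"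
        unfolding PQS by (simp add: algebra_simps)
      also have "\<dots> = of_real (u i)" by (simp add: u_def complex_add_cnj)
      finally show ?thesis .
    qed
    have vw: "(\<Sum>j = 0..<n. of_real (v j) * w j) = of_real t * (P + Q + S)"
    proof -
      have "(\<Sum>j = 0..<n. of_real (v j) * w j) = (\<Sum>j = 0..<n. if j = k then of_real t * w k else 0)"
        by (rule sum.cong) (auto simp: v_def)
      then show ?thesis using k(1) by (simp add: w_def yk)
    qed
    have \<xi>: "\<xi> = of_real \<alpha> + \<i> * of_real \<beta>" "cnj \<xi> = of_real \<alpha> - \<i> * of_real \<beta>"
      by (simp_all add: \<xi>_def complex_eq_iff)
    have quad: "(z - \<xi>) * (z - cnj \<xi>) = (z - of_real \<alpha>)\<^sup>2 + (of_real \<beta>)\<^sup>2"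
      unfolding \<xi> by (simp add: algebra_simps power2_eq_square)
    have "(z - of_real a - of_real t * (P + Q + S)) * poly ?c z
      = (z - of_real a) * (z - of_real \<rho>) * ((z - \<xi>) * (z - cnj \<xi>))
        - of_real t * (((z - of_real \<rho>) * P) * ((z - \<xi>) * (z - cnj \<xi>))
            + (z - of_real \<rho>) * (((z - \<xi>) * Q) * (z - cnj \<xi>) + ((z - cnj \<xi>) * S) * (z - \<xi>)))"
      unfolding c by (simp add: algebra_simps)
    \<comment> \<open>After clearing, the bracket multiplied by \<open>t\<close> is \<open>(z -
      \<alpha>)\<^sup>2 + \<beta>\<^sup>2 + \<eta> * (z - \<rho>) * (z - \<alpha>)\<close>, since
      \<open>\<xi>\<close> and \<open>cnj \<xi>\<close> have mean \<open>\<alpha>\<close>;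
      collecting the factor \<open>z - \<alpha>\<close> gives the form in
      \<open>q_poly\<close>.\<close>
    also have "\<dots> = poly ?q z"
      unfolding PQS quad poly_map_q_poly unfolding \<xi> by (simp add: field_simps power2_eq_square)
    finally have "(z - of_real a - of_real t * (P + Q + S)) * poly ?c z = poly ?q z" .
    moreover have "poly (char_poly (map_mat complex_of_real M)) z
        = poly (char_poly ?Bc) z * (z - of_real a - of_real t * (P + Q + S))"
      unfolding Mc vw[symmetric] by (rule poly_char_poly_bordered_mat[OF Bc w])
    ultimately have "poly (char_poly (map_mat complex_of_real M)) z * poly ?c z
        = poly (char_poly ?Bc) z * poly ?q z"
      by (simp only: mult.assoc)
    then show ?thesis
      by (simp only: poly_mult[of _ ?c] poly_mult[of "char_poly ?Bc" ?q])
  qed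
  then have "char_poly (map_mat complex_of_real M) * ?c * ?c = char_poly ?Bc * ?q * ?c"
    by (intro iffD1[OF poly_eq_poly_eq_iff] ext)
  moreover have "?c \<noteq> 0" by simp
  ultimately have "char_poly (map_mat complex_of_real M) * ?c = char_poly ?Bc * ?q"
    by (simp only: mult_cancel_right simp_thms)
  then show ?thesis using M M_nonneg by blast
qed

section \<open>Realising the new list: comparison of root multisets\<close>

theorem theorem3p1:
  fixes m :: nat
    and \<rho> \<alpha> \<beta> a t \<eta> :: real
    and lam :: "nat \<Rightarrow> complex"
    and \<mu>1 \<mu>2 \<mu>3 \<mu>4 :: complex
  defines "xs \<equiv> [complex_of_real \<rho>, of_real \<alpha> + \<i> * of_real \<beta>, of_real \<alpha> - \<i> * of_real \<beta>]
                 @ map lam [4..<Suc m]"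
  assumes "m \<ge> 3"
    and "realisable xs"
    and "perron_eigenvalue \<rho> xs"
    and "\<beta> > 0"
    and "a \<ge> 0" and "t \<ge> 0"
    and "0 < \<eta>" and "\<eta> \<le> 1"
    and "proots (map_poly complex_of_real (q_poly \<rho> \<alpha> \<beta> a t \<eta>)) = {#\<mu>1, \<mu>2, \<mu>3, \<mu>4#}"
  shows "realisable ([\<mu>1, \<mu>2, \<mu>3, \<mu>4] @ map lam [4..<Suc m])"
proof -
  let ?q = "map_poly complex_of_real (q_poly \<rho> \<alpha> \<beta> a t \<eta>)"
  define n where "n = length xs"
  define \<xi> where "\<xi> = Complex \<alpha> \<beta>"
  let ?c = "[:-of_real \<rho>, 1:] * [:-\<xi>, 1:] * [:-cnj \<xi>, 1:] :: complex poly"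
  have \<xi>: "\<xi> = of_real \<alpha> + \<i> * of_real \<beta>" "cnj \<xi> = of_real \<alpha> - \<i> * of_real \<beta>"
    by (simp_all add: \<xi>_def complex_eq_iff)
  have n: "n > 0" by (simp add: n_def xs_def)
  obtain A where A: "A \<in> carrier_mat n n" and nonneg: "\<And>i j. i < n \<Longrightarrow> j < n \<Longrightarrow> 0 \<le> A $$ (i, j)"
    and roots: "proots (char_poly (map_mat complex_of_real A)) = mset xs"
    and \<rho>: "spectral_radius (map_mat complex_of_real A) = \<rho>"
    using \<open>perron_eigenvalue \<rho> xs\<close> unfolding perron_eigenvalue_def realises_def n_def by auto
  have hom: "char_poly (map_mat complex_of_real X) = map_poly of_real (char_poly X)"
    if "X \<in> carrier_mat n n" for X by (rule of_real_hom.char_poly_hom[OF that])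
  have root: "poly (char_poly (map_mat complex_of_real A)) z = 0" if "z \<in> set xs" for z
  proof -
    have "z \<in># proots (char_poly (map_mat complex_of_real A))" using that roots by simp
    then show ?thesis by (cases "char_poly (map_mat complex_of_real A) = 0") auto
  qed
  \<comment> \<open>The nonreal eigenvalue gives
    \<open>\<rho> \<ge> cmod \<xi> \<ge> \<beta> > 0\<close>, the positivity that
    \<open>ex_constant_row_sums\<close> asks for.\<close>
  have "eigenvalue (map_mat complex_of_real A) \<xi>"
    using root[of \<xi>] A by (subst eigenvalue_root_char_poly[of _ n]) (auto simp: xs_def \<xi>)
  then have "cmod \<xi> \<le> \<rho>"
    using norm_le_spectral_radius[of "map_mat complex_of_real A" n \<xi>] A n \<rho> by simp
  moreover have "\<beta> \<le> cmod \<xi>" using abs_Im_le_cmod[of \<xi>] by (simp add: \<xi>_def)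
  ultimately have \<rho>_pos: "\<rho> > 0" using \<open>\<beta> > 0\<close> by linarith
  obtain B where B: "B \<in> carrier_mat n n" "\<And>i j. i < n \<Longrightarrow> j < n \<Longrightarrow> 0 \<le> B $$ (i, j)"
    "char_poly B = char_poly A" "\<And>i. i < n \<Longrightarrow> (\<Sum>j = 0..<n. B $$ (i, j)) \<le> \<rho>"
    using ex_row_sums_le_spectral_radius[OF A nonneg n] unfolding \<rho> by auto
  \<comment> \<open>\<open>\<rho>\<close> is real, so it is already a root of the real
    characteristic polynomial, which \<open>A\<close> and \<open>B\<close> share; this yields a real
    eigenvector of \<open>B\<close>.\<close>
  have "poly (map_poly complex_of_real (char_poly A)) (of_real \<rho>) = 0"
    using root[of "of_real \<rho>"] hom[OF A] by (simp add: xs_def)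
  then have "eigenvalue B \<rho>"
    by (subst eigenvalue_root_char_poly[OF B(1)]) (simp add: B(3))
  then obtain C where C: "C \<in> carrier_mat n n" "\<And>i j. i < n \<Longrightarrow> j < n \<Longrightarrow> 0 \<le> C $$ (i, j)"
    "char_poly C = char_poly A" "\<And>i. i < n \<Longrightarrow> (\<Sum>j = 0..<n. C $$ (i, j)) = \<rho>"
    using ex_constant_row_sums[OF B(1,2,4) \<rho>_pos] B(3) by auto
  have Cc: "char_poly (map_mat complex_of_real C) = char_poly (map_mat complex_of_real A)"
    unfolding hom[OF C(1)] hom[OF A] C(3) ..
  have "eigenvalue (map_mat complex_of_real C) \<xi>"
    using root[of \<xi>] C(1) Cc by (subst eigenvalue_root_char_poly[of _ n]) (auto simp: xs_def \<xi>)
  then obtain M where M: "M \<in> carrier_mat (Suc n) (Suc n)"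
    "\<And>i j. i < Suc n \<Longrightarrow> j < Suc n \<Longrightarrow> 0 \<le> M $$ (i, j)"
    "char_poly (map_mat complex_of_real M) * ?c = char_poly (map_mat complex_of_real A) * ?q"
    using ex_bordered_realisation[of C n \<rho> \<alpha> \<beta> a t \<eta>] C assms Cc unfolding \<xi>_def by auto
  have nz: "char_poly (map_mat complex_of_real X) \<noteq> 0" if "X \<in> carrier_mat k k" for X k
    using degree_monic_char_poly[of "map_mat complex_of_real X" k] that by auto
  \<comment> \<open>By convention \<open>proots 0\<close> is empty, whereas \<open>?q\<close> has
    four roots.\<close>
  have "?q \<noteq> 0" using assms(10) by auto
  \<comment> \<open>Taking root multisets turns the product identity into an additive one; the three
    roots of \<open>?c\<close> are the first three entries of \<open>xs\<close> and cancel, leaving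
    the roots of \<open>?q\<close> and the remaining entries.\<close>
  then have "proots (char_poly (map_mat complex_of_real M)) + proots ?c = mset xs + proots ?q"
    using arg_cong[OF M(3), of proots] nz[OF M(1)] nz[OF A] roots
    by (subst (asm) (1 2) proots_mult) auto
  moreover have "proots ?c = {#of_real \<rho>, \<xi>, cnj \<xi>#}"
    by (subst proots_mult, simp, simp)+ simp
  ultimately have "proots (char_poly (map_mat complex_of_real M))
      = mset ([\<mu>1, \<mu>2, \<mu>3, \<mu>4] @ map lam [4..<Suc m])"
    using assms(10) by (simp add: xs_def \<xi>)
  moreover have "length ([\<mu>1, \<mu>2, \<mu>3, \<mu>4] @ map lam [4..<Suc m]) = Suc n"
    by (simp add: n_def xs_def)
  ultimately show ?thesis
    unfolding realisable_def realises_def using M(1,2) by metis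
qed

end
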